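(* For all $n,k\in\mathbb{N}$, the Changhee numbers of the second kind with order $k$ satisfy $$\widehat{Ch}_n^{(k)}=n!\sum_{i=0}^n\frac{(-1)^i}{2^i}\binom{k+i-1}{i}\binom{k}{n-i}.$$
   Context: For $k\in\mathbb{N}$, the Changhee numbers of the second kind with order $k$, denoted $\widehat{Ch}_n^{(k)}$, $n\ge 0$, are defined by the generating function (an identity of formal power series in $t$) $$\sum_{n=0}^\infty \widehat{Ch}_n^{(k)}\frac{t^n}{n!}=\left(\frac{2}{2+t}\right)^k(1+t)^k .$$ The usual convention $\binom{k}{j}=0$ for $j>k$ is used. $\mathbb{N}$ denotes the positive integers. *)

theory Defs
  imports "HOL-Computational_Algebra.Formal_Power_Series"
begin

definition changhee2_gf :: "nat \<Rightarrow> rat fps" where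
  "changhee2_gf k = (2 / (2 + fps_X)) ^ k * (1 + fps_X) ^ k"

(* changhee2 k n is the n-th Changhee number of the second kind with order k: the generating
   function is exponential, hence the factor n!. The numbers are rational. *)
definition changhee2 :: "nat \<Rightarrow> nat \<Rightarrow> rat" where
  "changhee2 k n = fact n * fps_nth (changhee2_gf k) n"

lemma changhee2_egf:
  "Abs_fps (\<lambda>n. changhee2 k n / fact n) = (2 / (2 + fps_X)) ^ k * (1 + fps_X) ^ k"
  by (rule fps_ext) (simp add: changhee2_def changhee2_gf_def)

(* Division of formal power series is total, so 2 / (2 + t) needs this to be the true quotient. *)
lemma two_divide_two_plus_X: "(2 / (2 + fps_X)) * (2 + fps_X) = (2 :: rat fps)"
proof -
  have "fps_nth (2 + fps_X :: rat fps) 0 \<noteq> 0"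
    by (simp add: numeral_fps_const)
  then show ?thesis
    by (simp add: fps_divide_unit mult.assoc inverse_mult_eq_1)
qed

end

theory Submission
  imports Defs
begin

text \<open>Dividing numerator and denominator by \<open>2\<close> turns the first factor of the generating function
  into \<open>(1 + t/2)\<close> to the power \<open>-k\<close>. Its coefficients are given by the negative binomial series,
  those of \<open>(1 + t)\<close> to the power \<open>k\<close> by the binomial theorem, and the claimed sum is the Cauchy
  product of the two.\<close>

text \<open>The form \<open>1 - c t\<close> with \<open>c = - 1 / 2\<close> is the one in which the negative binomial series has
  coefficients \<open>((k + i - 1) choose i) * c ^ i\<close>, with an ordinary binomial coefficient; the factor
  \<open>(-1) ^ i / 2 ^ i\<close> of the claimed sum is this \<open>c ^ i\<close>.\<close>

lemma two_divide_two_plus_X_eq_inverse: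
  "2 / (2 + fps_X) = inverse (1 - fps_const (- 1 / 2) * fps_X :: rat fps)"
proof (rule fps_inverse_unique[symmetric])
  have "2 * (1 - fps_const (- 1 / 2) * fps_X) = (2 + fps_X :: rat fps)"
    by (simp add: numeral_fps_const distrib_left del: fps_const_neg
      flip: mult.assoc fps_const_neg)
  then have "2 * ((1 - fps_const (- 1 / 2) * fps_X) * (2 / (2 + fps_X))) =
    (2 / (2 + fps_X)) * (2 + fps_X :: rat fps)"
    by (simp only: mult.assoc[symmetric] mult.commute)
  also have "\<dots> = 2 * 1"
    by (simp only: two_divide_two_plus_X mult_1_right)
  finally show "(1 - fps_const (- 1 / 2) * fps_X) * (2 / (2 + fps_X)) = (1 :: rat fps)"
    by (simp only: mult_cancel_left) simp
qed

lemma fps_nth_two_divide_two_plus_X_power: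
  assumes "k \<ge> 1"
  shows "fps_nth ((2 / (2 + fps_X)) ^ k :: rat fps) i =
    (-1) ^ i / 2 ^ i * of_nat ((k + i - 1) choose i)"
proof -
  have "(2 / (2 + fps_X)) ^ k = inverse ((1 - fps_const (- 1 / 2) * fps_X :: rat fps) ^ k)"
    by (simp only: two_divide_two_plus_X_eq_inverse fps_inverse_power)
  also have "\<dots> = Abs_fps (\<lambda>i. of_nat ((k + i - 1) choose i) * (- 1 / 2) ^ i)"
    using assms by (intro one_minus_const_fps_X_neg_power') simp
  finally show ?thesis
    by (simp only: fps_nth_Abs_fps power_divide mult.commute)
qed

lemma fps_nth_one_plus_X_power:
  "fps_nth ((1 + fps_X) ^ k :: 'a::field_char_0 fps) j = of_nat (k choose j)"
  by (simp only: fps_binomial_of_nat[symmetric] fps_binomial_nth binomial_gbinomial)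

theorem theorem3p1:
  fixes n k :: nat
  assumes "n \<ge> 1" and "k \<ge> 1"
  shows "changhee2 k n =
    fact n * (\<Sum>i=0..n. (-1) ^ i / 2 ^ i * of_nat ((k + i - 1) choose i) * of_nat (k choose (n - i)))"
  unfolding changhee2_def changhee2_gf_def fps_mult_nth fps_nth_one_plus_X_power
    fps_nth_two_divide_two_plus_X_power[OF assms(2)] ..

end
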